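(* Let $x^0$ be a local minimum for the problem $$(Q)\qquad \min\ g(x_1,\dots,x_d)\quad\text{subject to } F_i(x)=0,\ i=1,\dots,l,\quad G_j(x)\le0,\ j=1,\dots,m,$$ at which the Mangasarian–Fromovitz condition described in the context holds. Then there are $\beta_j\ge0$, $j=1,\dots,m$, such that $$0=\nabla g(x^0)\cdot v_s(x^0)+\sum_{j=1}^m\beta_j\,\nabla G_j(x^0)\cdot v_s(x^0),\qquad s=1,\dots,d-l,$$ $$0=\beta_jG_j(x^0),\qquad j=1,\dots,m.$$
   Context: Setting: $1\le l\le d-1$ and $m\geq 1$ are integers, and $g$, $F_i$ ($i=1,\dots,l$), $G_j$ ($j=1,\dots,m$) are real valued functions in $C^1(\mathbb{R}^d)$. Mangasarian–Fromovitz condition at $x^0$: the Jacobian determinant $\det\left(\frac{\partial F_i}{\partial x_k}(x^0)\right)_{1\le i,k\le l}$ is nonzero, and there is a vector $h\in\mathbb{R}^d$ such that $\nabla F_i(x^0)\cdot h=0$ for $i=1,\dots,l$ and $\nabla G_j(x^0)\cdot h<0$ for $j\in I(x^0)$, where $I(x^0)=\{j: G_j(x^0)=0\}$ is the set of indices of active inequality constraints. For $s=1,\dots,d-l$, $v_s(x^0)\in\mathbb{R}^d$ is the unique vector with $v_s(x^0)\cdot\nabla F_i(x^0)=0$, $i=1,\dots,l$, whose last $d-l$ components are the $s$-th row of the identity matrix of $\mathbb{R}^{d-l}$. *)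

theory Defs
  imports "HOL-Analysis.Analysis"
begin

text \<open>
  The index set $\{1,\dots,d\}$ is the sum type \<open>'l + 'k\<close> with \<open>CARD('l) = l\<close> and
  \<open>CARD('k) = d - l\<close>: \<open>Inl\<close> gives the first $l$ coordinates, \<open>Inr\<close> the last $d-l$.
  Types are nonempty, so finite \<open>'l\<close> and \<open>'k\<close> range over exactly the cases
  $1 \le l \le d-1$.
\<close>

definition partial_deriv :: "(real ^ 'n \<Rightarrow> real) \<Rightarrow> 'n::finite \<Rightarrow> real ^ 'n \<Rightarrow> real" where
  "partial_deriv f k x = frechet_derivative f (at x) (axis k 1)"

definition gradient :: "(real ^ 'n::finite \<Rightarrow> real) \<Rightarrow> real ^ 'n \<Rightarrow> real ^ 'n" where
  "gradient f x = (\<chi> k. partial_deriv f k x)"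

definition C1 :: "(real ^ 'n::finite \<Rightarrow> real) \<Rightarrow> bool" where
  "C1 f \<longleftrightarrow> f differentiable_on UNIV \<and> continuous_on UNIV (gradient f)"

definition local_minimum_on :: "('a::metric_space \<Rightarrow> real) \<Rightarrow> 'a set \<Rightarrow> 'a \<Rightarrow> bool" where
  "local_minimum_on g S x0 \<longleftrightarrow>
     x0 \<in> S \<and> (\<exists>\<epsilon>>0. \<forall>x\<in>S. dist x x0 < \<epsilon> \<longrightarrow> g x0 \<le> g x)"

definition feasible_set :: "('i \<Rightarrow> 'a \<Rightarrow> real) \<Rightarrow> ('j \<Rightarrow> 'a \<Rightarrow> real) \<Rightarrow> 'a set" where
  "feasible_set F G = {x. (\<forall>i. F i x = 0) \<and> (\<forall>j. G j x \<le> 0)}"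

definition active_set :: "('j \<Rightarrow> 'a \<Rightarrow> real) \<Rightarrow> 'a \<Rightarrow> 'j set" where
  "active_set G x = {j. G j x = 0}"

definition mangasarian_fromovitz ::
  "('l \<Rightarrow> real ^ ('l::finite + 'k::finite) \<Rightarrow> real) \<Rightarrow> ('m \<Rightarrow> real ^ ('l + 'k) \<Rightarrow> real)
    \<Rightarrow> real ^ ('l + 'k) \<Rightarrow> bool" where
  "mangasarian_fromovitz F G x0 \<longleftrightarrow>
     det ((\<chi> i k. partial_deriv (F i) (Inl k) x0) :: real ^ 'l ^ 'l) \<noteq> 0 \<and>
     (\<exists>h. (\<forall>i. gradient (F i) x0 \<bullet> h = 0) \<and>
          (\<forall>j\<in>active_set G x0. gradient (G j) x0 \<bullet> h < 0))"

definition tangent_vec ::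
  "('l \<Rightarrow> real ^ ('l::finite + 'k::finite) \<Rightarrow> real) \<Rightarrow> real ^ ('l + 'k) \<Rightarrow> 'k
    \<Rightarrow> real ^ ('l + 'k)" where
  "tangent_vec F x0 s = (THE v.
     (\<forall>i. v \<bullet> gradient (F i) x0 = 0) \<and>
     (\<forall>r. v $ Inr r = (mat 1 :: real ^ 'k ^ 'k) $ s $ r))"

lemma C1_imp_GDERIV:
  assumes "C1 f"
  shows "GDERIV f x :> gradient f x"
proof -
  let ?D = "frechet_derivative f (at x)"
  have "f differentiable at x"
    using assms by (auto simp: C1_def differentiable_on_def)
  then have D: "(f has_derivative ?D) (at x)"
    by (simp add: frechet_derivative_works)
  then have lin: "linear ?D"
    by (rule has_derivative_linear)
  have "?D h = h \<bullet> gradient f x" for h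
  proof -
    have "?D h = ?D (\<Sum>k\<in>UNIV. h $ k *\<^sub>R axis k 1)"
      by (simp add: basis_expansion flip: scalar_mult_eq_scaleR)
    also have "\<dots> = (\<Sum>k\<in>UNIV. h $ k * ?D (axis k 1))"
      by (simp add: linear_sum[OF lin] linear_scale[OF lin])
    also have "\<dots> = h \<bullet> gradient f x"
      by (simp add: inner_vec_def gradient_def partial_deriv_def)
    finally show ?thesis .
  qed
  then have "?D = (\<lambda>h. h \<bullet> gradient f x)"
    by blast
  with D show ?thesis
    by (simp add: gderiv_def)
qed

lemma tangent_vec_ex1:
  fixes F :: "'l \<Rightarrow> real ^ ('l::finite + 'k::finite) \<Rightarrow> real"
  assumes "det ((\<chi> i k. partial_deriv (F i) (Inl k) x0) :: real ^ 'l ^ 'l) \<noteq> 0"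
  shows "\<exists>!v. (\<forall>i. v \<bullet> gradient (F i) x0 = 0) \<and>
              (\<forall>r. v $ Inr r = (mat 1 :: real ^ 'k ^ 'k) $ s $ r)"
proof -
  define A :: "real ^ 'l ^ 'l" where "A = (\<chi> i k. partial_deriv (F i) (Inl k) x0)"
  define b :: "real ^ 'l" where "b = (\<chi> i. - partial_deriv (F i) (Inr s) x0)"
  have inv: "invertible A"
    using assms by (simp add: A_def invertible_det_nz)
  have sum_split: "(\<Sum>k\<in>UNIV. f k) = (\<Sum>k\<in>UNIV. f (Inl k)) + (\<Sum>r\<in>UNIV. f (Inr r))"
    for f :: "'l + 'k \<Rightarrow> real"
    by (simp add: UNIV_Plus_UNIV[symmetric] sum.Plus del: UNIV_Plus_UNIV)
  have iff: "(\<forall>i. v \<bullet> gradient (F i) x0 = 0) \<longleftrightarrow> A *v (\<chi> k. v $ Inl k) = b"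
    if "\<forall>r. v $ Inr r = (mat 1 :: real ^ 'k ^ 'k) $ s $ r" for v
  proof -
    have "v \<bullet> gradient (F i) x0 = (A *v (\<chi> k. v $ Inl k)) $ i - b $ i" for i
      using that
      by (simp add: inner_vec_def gradient_def sum_split A_def b_def matrix_vector_mult_def
          mat_def mult.commute if_distrib[of "\<lambda>t. _ * t"] cong: if_cong)
    then show ?thesis
      by (simp add: vec_eq_iff)
  qed
  obtain w where w: "A *v w = b"
    using inv by (metis invertible_def matrix_vector_mul_assoc matrix_vector_mul_lid)
  have uniq: "w' = w" if "A *v w' = b" for w'
    using inv w that by (metis invertible_def matrix_vector_mul_assoc matrix_vector_mul_lid)
  let ?v = "(\<chi> k. case k of Inl a \<Rightarrow> w $ a | Inr r \<Rightarrow> (mat 1 :: real ^ 'k ^ 'k) $ s $ r)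
             :: real ^ ('l + 'k)"
  show ?thesis
  proof (rule ex1I[of _ ?v])
    show "(\<forall>i. ?v \<bullet> gradient (F i) x0 = 0) \<and>
          (\<forall>r. ?v $ Inr r = (mat 1 :: real ^ 'k ^ 'k) $ s $ r)"
      using iff[of ?v] w by simp
  next
    fix v
    assume v: "(\<forall>i. v \<bullet> gradient (F i) x0 = 0) \<and>
               (\<forall>r. v $ Inr r = (mat 1 :: real ^ 'k ^ 'k) $ s $ r)"
    then have "(\<chi> k. v $ Inl k) = w"
      using iff[of v] uniq by blast
    then have "v $ Inl a = w $ a" for a
      by (auto simp: vec_eq_iff)
    with v show "v = ?v"
      by (simp add: vec_eq_iff split: sum.split)
  qed
qed

end

theory Submission
  imports Defs
begin

text \<open>
  Gordan's alternative reduces the claim to showing that no direction tangent to the equality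
  constraints strictly decreases \<open>g\<close> and all active \<open>G j\<close> at once. Such a direction would be
  the velocity of a curve inside the equality constraints, obtained from the inverse function
  theorem for the map with components \<open>F i\<close> and the last $d-l$ coordinates, and moving along
  the curve would contradict minimality. In the resulting Fritz John relation the weight of
  \<open>g\<close> cannot vanish: otherwise pairing with the Mangasarian--Fromovitz vector
  gives a negative number.
\<close>

section \<open>Convex hulls of finite families and Gordan's alternative\<close>

text \<open>Weights are attached to indices rather than to points because \<open>a\<close> need not
  be injective: two constraints may have the same reduced gradient. The set \<open>?C\<close> of all
  such combinations is convex and contains every \<open>a i\<close>, hence the whole hull.\<close>

lemma convex_hull_image_finite:
  fixes a :: "'i \<Rightarrow> 'a::real_vector"
  assumes "finite I" and "y \<in> convex hull (a ` I)"
  obtains u where "\<And>i. i \<in> I \<Longrightarrow> 0 \<le> u i" "sum u I = 1" "y = (\<Sum>i\<in>I. u i *\<^sub>R a i)"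
proof -
  let ?C = "{y. \<exists>u. (\<forall>i\<in>I. 0 \<le> u i) \<and> sum u I = 1 \<and> y = (\<Sum>i\<in>I. u i *\<^sub>R a i)}"
  have "convex hull (a ` I) \<subseteq> ?C"
  proof (rule hull_minimal)
    show "a ` I \<subseteq> ?C"
    proof clarify
      fix i assume "i \<in> I"
      then show "\<exists>u. (\<forall>i\<in>I. 0 \<le> u i) \<and> sum u I = 1 \<and> a i = (\<Sum>i\<in>I. u i *\<^sub>R a i)"
        using \<open>finite I\<close>
        by (intro exI[of _ "\<lambda>j. if j = i then 1 else 0"])
          (simp add: if_distrib[of "\<lambda>t. t *\<^sub>R _"] cong: if_cong)
    qed
    show "convex ?C"
    proof (rule convexI, clarify)
      fix p q :: real and u v :: "'i \<Rightarrow> real"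
      assume "0 \<le> p" "0 \<le> q" "p + q = 1"
        and "\<forall>i\<in>I. 0 \<le> u i" "sum u I = 1" "\<forall>i\<in>I. 0 \<le> v i" "sum v I = 1"
      then show "\<exists>w. (\<forall>i\<in>I. 0 \<le> w i) \<and> sum w I = 1 \<and>
          p *\<^sub>R (\<Sum>i\<in>I. u i *\<^sub>R a i) + q *\<^sub>R (\<Sum>i\<in>I. v i *\<^sub>R a i) = (\<Sum>i\<in>I. w i *\<^sub>R a i)"
        by (intro exI[of _ "\<lambda>i. p * u i + q * v i"])
          (simp add: sum.distrib scaleR_sum_right scaleR_left_distrib flip: sum_distrib_left)
    qed
  qed
  with assms(2) that show thesis by blast
qed

text \<open>If 0 were outside the hull, which is compact, a hyperplane would separate them with
  \<open>w \<bullet> x\<close> positive on the hull, and \<open>- w\<close> would pair negatively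
  with every \<open>a i\<close>.\<close>

lemma Gordan_alternative:
  fixes a :: "'i \<Rightarrow> 'a::euclidean_space"
  assumes "finite I" and no: "\<And>w. \<exists>i\<in>I. 0 \<le> a i \<bullet> w"
  obtains u where "\<And>i. i \<in> I \<Longrightarrow> 0 \<le> u i" "sum u I = 1" "(\<Sum>i\<in>I. u i *\<^sub>R a i) = 0"
proof -
  have "0 \<in> convex hull (a ` I)"
  proof (rule ccontr)
    assume "0 \<notin> convex hull (a ` I)"
    moreover have "closed (convex hull (a ` I))"
      using \<open>finite I\<close> by (simp add: compact_imp_closed finite_imp_compact_convex_hull)
    ultimately obtain w b where "0 < b" "\<forall>x\<in>convex hull (a ` I). b < w \<bullet> x"
      using separating_hyperplane_closed_0[of "convex hull (a ` I)"] by auto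
    then have "\<And>i. i \<in> I \<Longrightarrow> a i \<bullet> (- w) < 0"
      by (metis hull_inc imageI inner_commute inner_minus_right neg_less_0_iff_less order_less_trans)
    then show False using no[of "- w"] by force
  qed
  with \<open>finite I\<close> show thesis
    using that convex_hull_image_finite by metis
qed

section \<open>Gradients, and curves from the inverse function theorem\<close>

lemma GDERIV_imp_gradient:
  assumes "GDERIV f x :> D"
  shows "gradient f x = D"
proof -
  have "frechet_derivative f (at x) = (\<lambda>h. h \<bullet> D)"
    using assms frechet_derivative_at unfolding gderiv_def by metis
  then show ?thesis
    by (simp add: gradient_def partial_deriv_def vec_eq_iff inner_axis')
qed

text \<open>Coordinate functions will complete the \<open>F i\<close> to a map of the whole space to
  itself, so their gradients are needed.\<close>

lemma gradient_vec_nth: "gradient (\<lambda>x. x $ k) x = axis k 1"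
  by (rule GDERIV_imp_gradient)
    (auto simp: gderiv_def inner_axis intro!: bounded_linear_imp_has_derivative bounded_linear_vec_nth)

lemma C1_vec_nth: "C1 (\<lambda>x. x $ k)"
  unfolding C1_def gradient_vec_nth
  by (auto intro!: bounded_linear_imp_differentiable_on bounded_linear_vec_nth)

text \<open>The hypothesis \<open>inj\<close> says that the Jacobian at \<open>x0\<close> has
  trivial kernel, so \<open>f\<close> is locally invertible. The curve is the preimage of a straight
  line, hence every component of \<open>f\<close> is exactly affine along it, not merely to first
  order.\<close>

lemma C1_local_curve:
  fixes f :: "real ^ 'n::finite \<Rightarrow> real ^ 'n"
  assumes C1: "\<And>k. C1 (\<lambda>x. f x $ k)"
    and inj: "\<And>h. (\<And>k. gradient (\<lambda>x. f x $ k) x0 \<bullet> h = 0) \<Longrightarrow> h = 0"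
  obtains c where "c 0 = x0" "(c has_vector_derivative h) (at 0)"
    "\<forall>\<^sub>F t in at_right 0. \<forall>k. f (c t) $ k = f x0 $ k + t * (gradient (\<lambda>x. f x $ k) x0 \<bullet> h)"
proof -
  define D where "D x v = (\<chi> k. gradient (\<lambda>x. f x $ k) x \<bullet> v)" for x v
  have lin: "linear (D x)" for x
    by (rule linearI) (simp_all add: D_def vec_eq_iff inner_add_right)
  then have bl: "bounded_linear (D x)" for x
    by (simp add: linear_conv_bounded_linear)
  have apply_D: "blinfun_apply (Blinfun (D x)) = D x" for x
    by (simp add: bl bounded_linear_Blinfun_apply)
  have D: "(f has_derivative D x) (at x)" for x
    unfolding has_derivative_componentwise_within[of f]
    using C1_imp_GDERIV[OF C1]
    by (auto simp: Basis_vec_def inner_axis D_def gderiv_def inner_commute[of "gradient _ _"])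
  \<comment> \<open>The inverse function theorem wants continuity in operator norm; in finite
    dimension it suffices to test it on basis vectors.\<close>
  have "continuous_on UNIV (\<lambda>x. Blinfun (D x))"
  proof (rule continuous_on_blinfun_componentwise, unfold apply_D D_def)
    show "continuous_on UNIV (\<lambda>x. \<chi> k. gradient (\<lambda>x. f x $ k) x \<bullet> i)" for i
      using C1 unfolding C1_def by (intro continuous_intros) auto
  qed
  \<comment> \<open>Trivial kernel yields a linear left inverse \<open>E\<close>, the form of
    invertibility that the inverse function theorem takes.\<close>
  moreover have "inj (D x0)"
    unfolding linear_injective_0[OF lin]
    using inj by (simp add: D_def vec_eq_iff)
  then obtain E where "linear E" and E: "E \<circ> D x0 = id"
    using linear_injective_left_inverse[OF lin] by blast
  then have "Blinfun E o\<^sub>L Blinfun (D x0) = id_blinfun"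
    by (intro blinfun_eqI)
      (simp add: apply_D bounded_linear_Blinfun_apply linear_conv_bounded_linear pointfree_idE)
  ultimately obtain U V p p' where inv: "open V" "f x0 \<in> V" "x0 \<in> U" "homeomorphism U V f p"
      and p: "\<And>y. y \<in> V \<Longrightarrow> (p has_derivative p' y) (at y)"
      and p': "\<And>y. y \<in> V \<Longrightarrow> p' y = inv (blinfun_apply (Blinfun (D (p y))))"
    using inverse_function_theorem[of UNIV f "\<lambda>x. Blinfun (D x)" x0 "Blinfun E"] D
    unfolding apply_D by (metis UNIV_I open_UNIV)
  have px0: "p (f x0) = x0"
    using inv by (simp add: homeomorphism_def)
  \<comment> \<open>The line has velocity \<open>D x0 h\<close>, which the derivative of the local
    inverse \<open>p\<close> turns back into \<open>h\<close>.\<close>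
  define c where "c t = p (f x0 + t *\<^sub>R D x0 h)" for t
  have pder: "(p has_derivative inv (D x0)) (at (f x0))"
    using p[OF inv(2)] p'[OF inv(2)] by (simp add: px0 apply_D)
  show thesis
  proof
    show "c 0 = x0" by (simp add: c_def px0)
    have line: "((\<lambda>t. f x0 + t *\<^sub>R D x0 h) has_vector_derivative D x0 h) (at 0)"
      by (auto intro!: derivative_eq_intros)
    have "(c has_vector_derivative inv (D x0) (D x0 h)) (at 0)"
      using vector_derivative_diff_chain_within[OF line, of p "inv (D x0)"]
        has_derivative_at_withinI[OF pder]
      by (simp add: c_def[abs_def] o_def)
    then show "(c has_vector_derivative h) (at 0)"
      by (simp add: \<open>inj (D x0)\<close>)
    \<comment> \<open>The identity \<open>f (p y) = y\<close> is available only on \<open>V\<close>,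
      which the line does not leave for small \<open>t\<close>.\<close>
    have "((\<lambda>t. f x0 + t *\<^sub>R D x0 h) \<longlongrightarrow> f x0 + 0 *\<^sub>R D x0 h) (at_right 0)"
      by (intro tendsto_intros)
    then have "\<forall>\<^sub>F t in at_right 0. f x0 + t *\<^sub>R D x0 h \<in> V"
      using topological_tendstoD[OF _ inv(1)] inv(2) by simp
    then show "\<forall>\<^sub>F t in at_right 0. \<forall>k. f (c t) $ k = f x0 $ k + t * (gradient (\<lambda>x. f x $ k) x0 \<bullet> h)"
    proof eventually_elim
      case (elim t)
      then have "f (c t) = f x0 + t *\<^sub>R D x0 h"
        using inv(4) by (simp add: c_def homeomorphism_def)
      then show ?case by (simp add: D_def)
    qed
  qed
qed

text \<open>By the chain rule the pairing \<open>gradient f (c 0) \<bullet> h\<close> is the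
  derivative of \<open>f\<close> along \<open>c\<close> at 0.\<close>

lemma eventually_less_along_curve:
  assumes "C1 f" and "(c has_vector_derivative h) (at 0)" and "gradient f (c 0) \<bullet> h < 0"
  shows "\<forall>\<^sub>F t in at_right 0. f (c t) < f (c 0)"
proof -
  have "((\<lambda>t. f (c t)) has_derivative (\<lambda>t. (t *\<^sub>R h) \<bullet> gradient f (c 0))) (at 0)"
    using has_derivative_compose[OF assms(2)[unfolded has_vector_derivative_def]]
      C1_imp_GDERIV[OF assms(1)] unfolding gderiv_def by blast
  then have "((\<lambda>t. f (c t)) has_real_derivative gradient f (c 0) \<bullet> h) (at 0)"
    by (simp add: has_field_derivative_def inner_commute mult_commute_abs)
  then obtain d where "0 < d" "\<forall>t>0. 0 + t \<in> UNIV \<longrightarrow> t < d \<longrightarrow> f (c (0 + t)) < f (c 0)"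
    using has_real_derivative_neg_dec_right assms(3) by metis
  then show ?thesis
    unfolding eventually_at_right_field by auto
qed

section \<open>Directions tangent to the equality constraints\<close>

text \<open>The nonzero determinant makes the definite description in \<open>tangent_vec\<close>
  meaningful, by \<open>tangent_vec_ex1\<close>.\<close>

lemma tangent_vec_spec:
  fixes F :: "'l \<Rightarrow> real ^ ('l::finite + 'k::finite) \<Rightarrow> real"
  assumes "det ((\<chi> i k. partial_deriv (F i) (Inl k) x0) :: real ^ 'l ^ 'l) \<noteq> 0"
  shows "gradient (F i) x0 \<bullet> tangent_vec F x0 s = 0"
    and "tangent_vec F x0 s $ Inr r = (if s = r then 1 else 0)"
  using theI'[OF tangent_vec_ex1[OF assms, of s]]
  unfolding tangent_vec_def by (auto simp: mat_def inner_commute)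

text \<open>Adding \<open>h\<close> to a tangent vector would give a second solution of the system
  that characterises that vector, so uniqueness forces \<open>h = 0\<close>.\<close>

lemma tangent_determined_by_last:
  fixes F :: "'l \<Rightarrow> real ^ ('l::finite + 'k::finite) \<Rightarrow> real"
  assumes det: "det ((\<chi> i k. partial_deriv (F i) (Inl k) x0) :: real ^ 'l ^ 'l) \<noteq> 0"
    and "\<And>i. gradient (F i) x0 \<bullet> h = 0" and "\<And>r. h $ Inr r = 0"
  shows "h = 0"
proof -
  \<comment> \<open>Any index serves; one exists because types are nonempty.\<close>
  obtain s :: 'k where True by simp
  let ?P = "\<lambda>v. (\<forall>i. v \<bullet> gradient (F i) x0 = 0) \<and>
    (\<forall>r. v $ Inr r = (mat 1 :: real ^ 'k ^ 'k) $ s $ r)"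
  obtain v where "?P v"
    using tangent_vec_ex1[OF det, of s] by blast
  moreover from this have "?P (v + h)"
    using assms(2,3) by (simp add: inner_add_left inner_commute)
  ultimately have "v + h = v"
    using tangent_vec_ex1[OF det, of s] by blast
  then show ?thesis by simp
qed

lemma no_descent_direction:
  fixes F :: "'l \<Rightarrow> real ^ ('l::finite + 'k::finite) \<Rightarrow> real"
    and G :: "'m::finite \<Rightarrow> real ^ ('l + 'k) \<Rightarrow> real"
  assumes g: "C1 g" and F: "\<And>i. C1 (F i)" and G: "\<And>j. C1 (G j)"
    and min: "local_minimum_on g (feasible_set F G) x0"
    and det: "det ((\<chi> i k. partial_deriv (F i) (Inl k) x0) :: real ^ 'l ^ 'l) \<noteq> 0"
    and hF: "\<And>i. gradient (F i) x0 \<bullet> h = 0"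
    and hG: "\<And>j. j \<in> active_set G x0 \<Longrightarrow> gradient (G j) x0 \<bullet> h < 0"
  shows "0 \<le> gradient g x0 \<bullet> h"
proof (rule ccontr)
  assume "\<not> 0 \<le> gradient g x0 \<bullet> h"
  then have hg: "gradient g x0 \<bullet> h < 0" by simp
  obtain \<epsilon> where feas: "x0 \<in> feasible_set F G" and "0 < \<epsilon>"
    and \<epsilon>: "\<And>x. x \<in> feasible_set F G \<Longrightarrow> dist x x0 < \<epsilon> \<Longrightarrow> g x0 \<le> g x"
    using min unfolding local_minimum_on_def by blast
  \<comment> \<open>The Jacobian of \<open>f\<close> is block triangular, with the invertible block
    of \<open>det\<close> and an identity block.\<close>
  define f where "f x = (\<chi> k. case k of Inl i \<Rightarrow> F i x | Inr r \<Rightarrow> x $ Inr r)" for x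
  have f_Inl: "(\<lambda>x. f x $ Inl i) = F i" and f_Inr: "(\<lambda>x. f x $ Inr r) = (\<lambda>x. x $ Inr r)" for i r
    by (simp_all add: f_def)
  have C1f: "C1 (\<lambda>x. f x $ k)" for k
    by (cases k) (simp_all only: f_Inl f_Inr F C1_vec_nth)
  have injf: "v = 0" if "\<And>k. gradient (\<lambda>x. f x $ k) x0 \<bullet> v = 0" for v
  proof (rule tangent_determined_by_last[OF det])
    show "gradient (F i) x0 \<bullet> v = 0" for i
      using that[of "Inl i"] by (simp only: f_Inl)
    show "v $ Inr r = 0" for r
      using that[of "Inr r"] by (simp add: f_Inr gradient_vec_nth inner_axis')
  qed
  obtain c where c0: "c 0 = x0" and c: "(c has_vector_derivative h) (at 0)"
    and f_c: "\<forall>\<^sub>F t in at_right 0. \<forall>k. f (c t) $ k = f x0 $ k + t * (gradient (\<lambda>x. f x $ k) x0 \<bullet> h)"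
    using C1_local_curve[OF C1f injf] by blast
  have c_lim: "(c \<longlongrightarrow> x0) (at_right 0)"
    using has_vector_derivative_continuous[OF c] c0
    by (metis continuous_within filterlim_at_split)
  \<comment> \<open>The component \<open>Inl i\<close> of \<open>f\<close> is affine in
    \<open>t\<close> with slope \<open>gradient (F i) x0 \<bullet> h\<close>, which is 0.\<close>
  have "\<forall>\<^sub>F t in at_right 0. \<forall>i. F i (c t) = 0"
    using f_c
  proof eventually_elim
    case (elim t)
    have "F i (c t) = F i x0" for i
      using elim[rule_format, of "Inl i"] by (simp add: hF f_Inl fun_cong[OF f_Inl])
    then show ?case
      using feas by (simp add: feasible_set_def)
  qed
  \<comment> \<open>Active constraints decrease to first order by \<open>hG\<close>; inactive ones
    stay negative by continuity. Finiteness of the index type then gives one range of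
    \<open>t\<close> for all \<open>j\<close>.\<close>
  moreover have "\<forall>\<^sub>F t in at_right 0. G j (c t) \<le> 0" for j
  proof (cases "j \<in> active_set G x0")
    case True
    then have "\<forall>\<^sub>F t in at_right 0. G j (c t) < G j x0"
      using eventually_less_along_curve[OF G c] hG c0 by simp
    then show ?thesis
      using True by (auto simp: active_set_def elim: eventually_mono)
  next
    case False
    then have "G j x0 < 0"
      using feas by (auto simp: active_set_def feasible_set_def less_le)
    moreover have "isCont (G j) x0"
      using C1_imp_GDERIV[OF G] unfolding gderiv_def by (rule has_derivative_continuous)
    then have "((\<lambda>t. G j (c t)) \<longlongrightarrow> G j x0) (at_right 0)"
      using c_lim isCont_tendsto_compose by blast
    ultimately have "\<forall>\<^sub>F t in at_right 0. G j (c t) < 0"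
      using order_tendstoD(2) by blast
    then show ?thesis by (rule eventually_mono) simp
  qed
  then have "\<forall>\<^sub>F t in at_right 0. \<forall>j. G j (c t) \<le> 0"
    by (rule eventually_all_finite)
  moreover have "\<forall>\<^sub>F t in at_right 0. g (c t) < g x0"
    using eventually_less_along_curve[OF g c] hg c0 by simp
  moreover have "\<forall>\<^sub>F t in at_right 0. dist (c t) x0 < \<epsilon>"
    using c_lim \<open>0 < \<epsilon>\<close> by (rule tendstoD)
  ultimately have "\<forall>\<^sub>F t in at_right (0::real). False"
    by eventually_elim (use \<epsilon> in \<open>force simp: feasible_set_def\<close>)
  then show False by simp
qed

section \<open>Extraction of the multipliers\<close>

theorem theorem7:
  fixes g :: "real ^ ('l::finite + 'k::finite) \<Rightarrow> real"
    and F :: "'l \<Rightarrow> real ^ ('l + 'k) \<Rightarrow> real"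
    and G :: "'m::finite \<Rightarrow> real ^ ('l + 'k) \<Rightarrow> real"
    and x0 :: "real ^ ('l + 'k)"
  assumes "C1 g"
    and "\<And>i. C1 (F i)"
    and "\<And>j. C1 (G j)"
    and "local_minimum_on g (feasible_set F G) x0"
    and "mangasarian_fromovitz F G x0"
  shows "\<exists>\<beta> :: 'm \<Rightarrow> real.
    (\<forall>j. 0 \<le> \<beta> j) \<and>
    (\<forall>s. 0 = gradient g x0 \<bullet> tangent_vec F x0 s
            + (\<Sum>j\<in>UNIV. \<beta> j * (gradient (G j) x0 \<bullet> tangent_vec F x0 s))) \<and>
    (\<forall>j. 0 = \<beta> j * G j x0)"
proof -
  let ?v = "tangent_vec F x0" and ?J = "active_set G x0"
  obtain h where det: "det ((\<chi> i k. partial_deriv (F i) (Inl k) x0) :: real ^ 'l ^ 'l) \<noteq> 0"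
    and hF: "\<And>i. gradient (F i) x0 \<bullet> h = 0"
    and hG: "\<And>j. j \<in> ?J \<Longrightarrow> gradient (G j) x0 \<bullet> h < 0"
    using assms(5) unfolding mangasarian_fromovitz_def by blast
  \<comment> \<open>The map \<open>red\<close> is the adjoint of the parametrisation of the tangent
    space by its last coordinates. Applying Gordan to reduced gradients tests tangent directions
    only, so no multipliers for the \<open>F i\<close> arise.\<close>
  define red :: "real ^ ('l + 'k) \<Rightarrow> real ^ 'k" where "red y = (\<chi> s. y \<bullet> ?v s)" for y
  have red_inner: "red y \<bullet> w = y \<bullet> (\<Sum>s\<in>UNIV. w $ s *\<^sub>R ?v s)" for y w
    by (simp add: red_def inner_vec_def[of "vec_lambda _"] inner_sum_right mult.commute)
  have h_eq: "h = (\<Sum>s\<in>UNIV. (\<chi> s. h $ Inr s) $ s *\<^sub>R ?v s)"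
  proof -
    \<comment> \<open>Both vectors are tangent and share their last coordinates.\<close>
    have "h - (\<Sum>s\<in>UNIV. h $ Inr s *\<^sub>R ?v s) = 0"
      by (rule tangent_determined_by_last[OF det])
        (simp_all add: inner_diff_right inner_sum_right hF tangent_vec_spec[OF det]
          if_distrib[of "\<lambda>t. _ * t"] cong: if_cong)
    then show ?thesis by simp
  qed
  \<comment> \<open>\<open>None\<close> indexes the objective, \<open>Some j\<close> the constraint
    \<open>G j\<close>.\<close>
  define a where "a = (\<lambda>k. case k of None \<Rightarrow> red (gradient g x0) | Some j \<Rightarrow> red (gradient (G j) x0))"
  have "\<exists>k\<in>insert None (Some ` ?J). 0 \<le> a k \<bullet> w" for w
  proof (rule ccontr)
    let ?w = "\<Sum>s\<in>UNIV. w $ s *\<^sub>R ?v s"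
    assume "\<not> ?thesis"
    then have neg: "gradient g x0 \<bullet> ?w < 0" "\<And>j. j \<in> ?J \<Longrightarrow> gradient (G j) x0 \<bullet> ?w < 0"
      by (auto simp: a_def red_inner)
    have "gradient (F i) x0 \<bullet> ?w = 0" for i
      by (simp add: inner_sum_right tangent_vec_spec[OF det])
    with neg no_descent_direction[OF assms(1-4) det, of ?w] show False
      by auto
  qed
  then obtain u where u: "\<And>k. k \<in> insert None (Some ` ?J) \<Longrightarrow> 0 \<le> u k"
    and u1: "sum u (insert None (Some ` ?J)) = 1"
    and u0: "(\<Sum>k\<in>insert None (Some ` ?J). u k *\<^sub>R a k) = 0"
    using Gordan_alternative[of "insert None (Some ` ?J)" a] by auto
  have u1': "u None + (\<Sum>j\<in>?J. u (Some j)) = 1"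
    using u1 by (simp add: sum.reindex image_iff)
  have rel: "u None *\<^sub>R red (gradient g x0) + (\<Sum>j\<in>?J. u (Some j) *\<^sub>R red (gradient (G j) x0)) = 0"
    using u0 by (simp add: sum.reindex image_iff a_def)
  have pos: "0 < u None"
  proof (rule ccontr)
    assume "\<not> 0 < u None"
    then have z: "u None = 0" using u[of None] by simp
    \<comment> \<open>Pairing \<open>rel\<close> with the last coordinates of \<open>h\<close>
      recovers pairings with \<open>h\<close> itself. All terms are nonnegative, so each vanishes;
      by \<open>hG\<close> all weights are then 0, although they sum to 1.\<close>
    have "(\<Sum>j\<in>?J. u (Some j) * - (gradient (G j) x0 \<bullet> h)) = 0"
      using arg_cong[OF rel, of "\<lambda>y. y \<bullet> (\<chi> s. h $ Inr s)"]
      by (simp add: z inner_sum_left red_inner sum_negf flip: h_eq[simplified])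
    then have "\<forall>j\<in>?J. u (Some j) * - (gradient (G j) x0 \<bullet> h) = 0"
      using u by (subst (asm) sum_nonneg_eq_0_iff) (auto intro!: mult_nonneg_nonpos less_imp_le[OF hG])
    then have "\<forall>j\<in>?J. u (Some j) = 0"
      using hG by fastforce
    with u1' z show False by simp
  qed
  \<comment> \<open>Dividing by \<open>u None\<close> gives \<open>g\<close> weight 1; the value 0
    off the active set yields complementary slackness.\<close>
  define \<beta> where "\<beta> j = (if j \<in> ?J then u (Some j) / u None else 0)" for j
  show ?thesis
  proof (intro exI[of _ \<beta>] conjI allI)
    show "0 \<le> \<beta> j" for j
      using u[of "Some j"] pos by (simp add: \<beta>_def)
    show "0 = \<beta> j * G j x0" for j
      by (simp add: \<beta>_def active_set_def)
    show "0 = gradient g x0 \<bullet> ?v s + (\<Sum>j\<in>UNIV. \<beta> j * (gradient (G j) x0 \<bullet> ?v s))" for s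
    proof -
      have "u None * (gradient g x0 \<bullet> ?v s) + (\<Sum>j\<in>?J. u (Some j) * (gradient (G j) x0 \<bullet> ?v s)) = 0"
        using arg_cong[OF rel, of "\<lambda>y. y $ s"] by (simp add: red_def)
      moreover have "(\<Sum>j\<in>UNIV. \<beta> j * (gradient (G j) x0 \<bullet> ?v s))
          = (\<Sum>j\<in>?J. u (Some j) * (gradient (G j) x0 \<bullet> ?v s)) / u None"
        unfolding sum_divide_distrib
        by (rule sum.mono_neutral_cong_right) (auto simp: \<beta>_def)
      ultimately have "u None * (gradient g x0 \<bullet> ?v s
          + (\<Sum>j\<in>UNIV. \<beta> j * (gradient (G j) x0 \<bullet> ?v s))) = 0"
        using pos by (simp add: distrib_left)
      then show ?thesis
        using pos by simp
    qed
  qed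
qed

end
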